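(* Let $s>t\ge1$ and $r\ge2$ be integers, and set $$\ell=\left\lceil \frac{r}{\left\lfloor \frac{2s-t-1}{s-t+1}\right\rfloor}\right\rceil .$$ Then $$L_{(s,t)}(n,r)\le (s-1)\binom{n}{\ell}+s-1.$$
   Context: An $r$-uniform hypergraph ($r$-graph) is a family (without repeated members) of $r$-element subsets, called edges, of a finite vertex set. For integers $s\ge t\ge1$, an $r$-graph is called locally $(s,t)$-thin if, among any $s$ distinct edges, at least $t$ of them contain a vertex that belongs to none of the other $s-1$ edges. $L_{(s,t)}(n,r)$ denotes the maximum number of edges in a locally $(s,t)$-thin $r$-graph on $n$ vertices. *)

theory Defs
  imports Complex_Main
begin

definition r_graph_on :: "nat \<Rightarrow> 'a set \<Rightarrow> 'a set set \<Rightarrow> bool" where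
  "r_graph_on r V E \<longleftrightarrow> finite V \<and> (\<forall>e\<in>E. e \<subseteq> V \<and> card e = r)"

definition locally_thin :: "nat \<Rightarrow> nat \<Rightarrow> 'a set set \<Rightarrow> bool" where
  "locally_thin s t E \<longleftrightarrow>
     (\<forall>F. F \<subseteq> E \<and> finite F \<and> card F = s \<longrightarrow>
        t \<le> card {e \<in> F. \<exists>v\<in>e. \<forall>f\<in>F - {e}. v \<notin> f})"

(* Vertices are taken to be natural numbers, which loses nothing up to relabelling;
   see L_max_upper below for arbitrary vertex types. *)
definition L_max :: "nat \<Rightarrow> nat \<Rightarrow> nat \<Rightarrow> nat \<Rightarrow> nat" where
  "L_max s t n r =
     Max {card E | (V :: nat set) E. card V = n \<and> r_graph_on r V E \<and> locally_thin s t E}"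

lemma L_max_set_finite:
  "finite {card E | (V :: nat set) E. card V = n \<and> r_graph_on r V E \<and> locally_thin s t E}"
proof (rule finite_subset)
  show "{card E | (V :: nat set) E. card V = n \<and> r_graph_on r V E \<and> locally_thin s t E} \<subseteq> {..2 ^ n}"
  proof
    fix k
    assume "k \<in> {card E | (V :: nat set) E. card V = n \<and> r_graph_on r V E \<and> locally_thin s t E}"
    then obtain V :: "nat set" and E where "k = card E" "card V = n" "r_graph_on r V E"
      by blast
    moreover from this have "E \<subseteq> Pow V" and "finite V"
      by (auto simp: r_graph_on_def)
    ultimately show "k \<in> {..2 ^ n}"
      by (metis atMost_iff card_Pow card_mono finite_Pow_iff)
  qed
qed simp

lemma L_max_set_nonempty:
  assumes "s \<ge> 1"
  shows "{card E | (V :: nat set) E. card V = n \<and> r_graph_on r V E \<and> locally_thin s t E} \<noteq> {}"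
proof -
  have "card {..<n} = n \<and> r_graph_on r {..<n} {} \<and> locally_thin s t ({} :: nat set set)"
    using assms by (auto simp: r_graph_on_def locally_thin_def)
  then show ?thesis
    by blast
qed

lemma locally_thin_image:
  assumes inj: "inj_on h V" and EV: "\<And>e. e \<in> E \<Longrightarrow> e \<subseteq> V" and thin: "locally_thin s t E"
  shows "locally_thin s t ((`) h ` E)"
  unfolding locally_thin_def
proof (intro allI impI)
  fix G
  assume G: "G \<subseteq> (`) h ` E \<and> finite G \<and> card G = s"
  have injE: "inj_on ((`) h) E"
    using inj EV by (intro inj_onI) (metis inj_on_image_eq_iff)
  obtain F where F: "F \<subseteq> E" "G = (`) h ` F"
    using G by (meson subset_imageE)
  have injF: "inj_on ((`) h) F"
    using injE F(1) by (rule inj_on_subset)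
  have "finite F" "card F = s"
    using G F(2) injF by (auto simp: finite_image_iff card_image)
  then have "t \<le> card {e \<in> F. \<exists>v\<in>e. \<forall>f\<in>F - {e}. v \<notin> f}"
    using thin F(1) by (auto simp: locally_thin_def)
  also have "\<dots> = card ((`) h ` {e \<in> F. \<exists>v\<in>e. \<forall>f\<in>F - {e}. v \<notin> f})"
    using injF by (subst card_image) (auto intro: inj_on_subset)
  also have "\<dots> \<le> card {e \<in> G. \<exists>v\<in>e. \<forall>f\<in>G - {e}. v \<notin> f}"
  proof (rule card_mono)
    show "finite {e \<in> G. \<exists>v\<in>e. \<forall>f\<in>G - {e}. v \<notin> f}"
      using G by simp
    show "(`) h ` {e \<in> F. \<exists>v\<in>e. \<forall>f\<in>F - {e}. v \<notin> f}
        \<subseteq> {e \<in> G. \<exists>v\<in>e. \<forall>f\<in>G - {e}. v \<notin> f}"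
    proof clarify
      fix e v
      assume e: "e \<in> F" "v \<in> e" "\<forall>f\<in>F - {e}. v \<notin> f"
      have "h v \<notin> h ` f" if "f \<in> F" "h ` f \<noteq> h ` e" for f
      proof -
        have "v \<notin> f"
          using e that by blast
        moreover have "v \<in> V" "f \<subseteq> V"
          using EV F(1) e that by auto
        ultimately show ?thesis
          using inj by (simp add: inj_on_image_mem_iff)
      qed
      then show "h ` e \<in> G \<and> (\<exists>v\<in>h ` e. \<forall>f\<in>G - {h ` e}. v \<notin> f)"
        using e F(2) by blast
    qed
  qed
  finally show "t \<le> card {e \<in> G. \<exists>v\<in>e. \<forall>f\<in>G - {e}. v \<notin> f}" .
qed

lemma L_max_upper:
  fixes V :: "'a set"
  assumes V: "card V = n" and E: "r_graph_on r V E" and thin: "locally_thin s t E"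
  shows "card E \<le> L_max s t n r"
proof -
  have fin: "finite V" and EV: "\<And>e. e \<in> E \<Longrightarrow> e \<subseteq> V"
    using E by (auto simp: r_graph_on_def)
  obtain h :: "'a \<Rightarrow> nat" where h: "inj_on h V"
    using fin finite_imp_inj_to_nat_seg by blast
  have "inj_on ((`) h) E"
    using h EV by (intro inj_onI) (metis inj_on_image_eq_iff)
  then have 1: "card ((`) h ` E) = card E"
    by (rule card_image)
  have "card (h ` V) = n"
    using h V by (simp add: card_image)
  moreover have "r_graph_on r (h ` V) ((`) h ` E)"
    unfolding r_graph_on_def
  proof (intro conjI ballI)
    fix e assume "e \<in> (`) h ` E"
    then obtain f where f: "f \<in> E" "e = h ` f" by blast
    then show "e \<subseteq> h ` V" using EV by blast
    have "inj_on h f" using h EV[OF f(1)] by (rule inj_on_subset)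
    then show "card e = r"
      using E f by (simp add: r_graph_on_def card_image)
  qed (use fin in simp)
  moreover have "locally_thin s t ((`) h ` E)"
    using h EV thin by (rule locally_thin_image)
  ultimately have "card E \<in> {card E | (V :: nat set) E. card V = n \<and> r_graph_on r V E \<and> locally_thin s t E}"
    using 1 by force
  then show ?thesis
    unfolding L_max_def by (rule Max_ge[OF L_max_set_finite])
qed

end

theory Submission imports Defs begin

text \<open>
  Write \<open>q\<close> for the floor and \<open>a = s - t + 1\<close>; then \<open>2 + a (q - 1) \<le> s\<close>. Delete, as long
  as possible, all edges through an \<open>l\<close>-set that lies in at least one but fewer than \<open>s\<close> of the
  remaining edges. Every \<open>l\<close>-set is used at most once, so if the bound failed then at least \<open>s\<close>
  edges would survive, and each \<open>l\<close>-subset of a surviving edge would lie in at least \<open>s\<close>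
  surviving edges. Start with two edges sharing
  \<open>l\<close> vertices; if \<open>q = 1\<close>, this is already absurd, since then \<open>l = r\<close>. Otherwise, an edge that already shares
  \<open>l\<close> vertices with another chosen edge has at most \<open>r - l \<le> (q - 1) l\<close> vertices left to
  cover, which takes \<open>q - 1\<close> new edges, each again sharing \<open>l\<close> vertices with the edge being
  covered. After \<open>a\<close> such steps at most \<open>s\<close> edges are chosen, and \<open>a\<close> of them have no
  private vertex, contradicting local thinness.
\<close>

definition rich :: "nat \<Rightarrow> nat \<Rightarrow> 'a set set \<Rightarrow> bool" where
  "rich s l E \<longleftrightarrow> (\<forall>e\<in>E. \<forall>T. T \<subseteq> e \<and> card T = l \<longrightarrow> s \<le> card {f \<in> E. T \<subseteq> f})"

lemma delete_light_sets:
  assumes "finite \<T>" and "finite E"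
  shows "\<exists>E' \<subseteq> E. card E \<le> card E' + (s - 1) * card \<T> \<and>
           (\<forall>T\<in>\<T>. \<forall>e\<in>E'. T \<subseteq> e \<longrightarrow> s \<le> card {f \<in> E'. T \<subseteq> f})"
  using assms
proof (induction \<T> arbitrary: E rule: finite_psubset_induct)
  case (psubset \<T>)
  show ?case
  proof (cases "\<forall>T\<in>\<T>. \<forall>e\<in>E. T \<subseteq> e \<longrightarrow> s \<le> card {f \<in> E. T \<subseteq> f}")
    case True
    then show ?thesis
      by (intro exI[of _ E]) auto
  next
    case False
    then obtain T where T: "T \<in> \<T>" and light: "card {f \<in> E. T \<subseteq> f} \<le> s - 1"
      by fastforce
    define D where "D = {f \<in> E. \<not> T \<subseteq> f}"
    have "\<T> - {T} \<subset> \<T>" and "finite D"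
      using T psubset.prems by (auto simp: D_def)
    from psubset.IH[OF this] obtain E' where E': "E' \<subseteq> D"
      "card D \<le> card E' + (s - 1) * card (\<T> - {T})"
      "\<forall>S\<in>\<T> - {T}. \<forall>e\<in>E'. S \<subseteq> e \<longrightarrow> s \<le> card {f \<in> E'. S \<subseteq> f}"
      by auto
    have "E = D \<union> {f \<in> E. T \<subseteq> f}"
      by (auto simp: D_def)
    then have "card E \<le> card D + card {f \<in> E. T \<subseteq> f}"
      by (metis card_Un_le)
    also have "\<dots> \<le> card E' + (s - 1) * card (\<T> - {T}) + (s - 1)"
      using E'(2) light by simp
    also have "\<dots> = card E' + (s - 1) * card \<T>"
      using card.remove[OF psubset.hyps T] by simp
    finally have "card E \<le> card E' + (s - 1) * card \<T>" .
    \<comment> \<open>For \<open>S = T\<close> the condition is vacuous, since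
      \<open>E' \<subseteq> D\<close>.\<close>
    moreover have "\<forall>S\<in>\<T>. \<forall>e\<in>E'. S \<subseteq> e \<longrightarrow> s \<le> card {f \<in> E'. S \<subseteq> f}"
      using E'(1,3) by (auto simp: D_def)
    moreover have "E' \<subseteq> E"
      using E'(1) by (auto simp: D_def)
    ultimately show ?thesis
      by blast
  qed
qed

lemma rich_subgraph:
  assumes E: "r_graph_on r V E"
  obtains E' where "E' \<subseteq> E" and "rich s l E'"
    and "card E \<le> card E' + (s - 1) * (card V choose l)"
proof -
  have V: "finite V" and EV: "E \<subseteq> Pow V"
    using E by (auto simp: r_graph_on_def)
  then have "finite E" and "finite {T. T \<subseteq> V \<and> card T = l}"
    by (auto intro: finite_subset)
  then obtain E' where E': "E' \<subseteq> E"
    "card E \<le> card E' + (s - 1) * card {T. T \<subseteq> V \<and> card T = l}"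
    "\<forall>T\<in>{T. T \<subseteq> V \<and> card T = l}. \<forall>e\<in>E'. T \<subseteq> e \<longrightarrow> s \<le> card {f \<in> E'. T \<subseteq> f}"
    using delete_light_sets[of "{T. T \<subseteq> V \<and> card T = l}" E s] by blast
  have "rich s l E'"
    unfolding rich_def using E'(1,3) EV by blast
  then show ?thesis
    using that E'(1,2) V by (simp add: n_subsets)
qed

lemma rich_new_edge:
  assumes "rich s l E" and "e \<in> E" and "T \<subseteq> e" and "card T = l"
    and "finite F" and "card F < s"
  obtains g where "g \<in> E" and "g \<notin> F" and "T \<subseteq> g"
proof -
  have "s \<le> card {f \<in> E. T \<subseteq> f}"
    using assms by (auto simp: rich_def)
  then have "\<not> {f \<in> E. T \<subseteq> f} \<subseteq> F"
    using assms(5,6) by (metis card_mono le_trans not_le)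
  then show ?thesis
    using that by blast
qed

text \<open>Richness speaks only of sets of size exactly \<open>l\<close>. So a small
  \<open>W\<close> is padded inside \<open>e\<close>, and a large one gives up \<open>l\<close> of
  its elements.\<close>

lemma subset_of_card_absorbing:
  assumes "finite e" and "W \<subseteq> e" and "l \<le> card e" and "card W \<le> l + k"
  obtains T where "T \<subseteq> e" and "card T = l" and "card (W - T) \<le> k"
proof (cases "card W \<le> l")
  case True
  then obtain T where "W \<subseteq> T" "T \<subseteq> e" "card T = l"
    using assms exists_subset_between[of W l e] by blast
  then show ?thesis
    using that[of T] by (simp add: Diff_eq_empty_iff[THEN iffD2])
next
  case False
  then obtain T where "T \<subseteq> W" "card T = l"
    using obtain_subset_with_card_n[of l W] by auto
  moreover from this have "card (W - T) = card W - l"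
    using assms(1,2) by (metis card_Diff_subset finite_subset)
  ultimately show ?thesis
    using that[of T] assms by auto
qed

text \<open>Each new edge contains an \<open>l\<close>-subset of \<open>e\<close> that absorbs up to
  \<open>l\<close> vertices of \<open>W\<close>. \<open>F\<close> holds the edges to avoid and grows
  along the induction; \<open>card F + m \<le> s\<close> keeps it below \<open>s\<close> whenever a
  new edge is needed.\<close>

lemma rich_cover:
  assumes "rich s l E" and "e \<in> E" and "finite e" and "l \<le> card e"
    and "W \<subseteq> e" and "card W \<le> m * l" and "finite F" and "card F + m \<le> s"
  shows "\<exists>G. G \<subseteq> E \<and> G \<inter> F = {} \<and> finite G \<and> card G = m \<and> W \<subseteq> \<Union>G \<and>
           (\<forall>g\<in>G. l \<le> card (g \<inter> e))"
  using assms(5-)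
proof (induction m arbitrary: W F)
  case 0
  then have "W = {}"
    using assms(3) by (metis card_0_eq finite_subset le_zero_eq mult_0)
  then show ?case
    by (intro exI[of _ "{}"]) auto
next
  case (Suc m)
  obtain T where T: "T \<subseteq> e" "card T = l" "card (W - T) \<le> m * l"
    using subset_of_card_absorbing[of e W l "m * l"] assms(3,4) Suc.prems(1,2) by auto
  obtain g where g: "g \<in> E" "g \<notin> F" "T \<subseteq> g"
    using rich_new_edge[OF assms(1,2) T(1,2), of F] Suc.prems by auto
  have "l \<le> card (g \<inter> e)"
    using T g(3) assms(3) by (metis card_mono finite_Int le_inf_iff)
  moreover obtain G where "G \<subseteq> E" "G \<inter> insert g F = {}" "finite G" "card G = m"
    "W - T \<subseteq> \<Union>G" "\<forall>g\<in>G. l \<le> card (g \<inter> e)"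
    using Suc.IH[of "W - T" "insert g F"] Suc.prems T(3) g(2) by auto
  ultimately show ?case
    using g by (intro exI[of _ "insert g G"]) auto
qed

text \<open>\<open>C\<close> collects the edges already covered by the others; each round adds one
  edge to \<open>C\<close> and \<open>p\<close> edges to \<open>F\<close>. The last conjunct is the
  invariant that keeps the next round affordable.\<close>

lemma rich_grow:
  assumes rich: "rich s l E" and E: "\<And>e. e \<in> E \<Longrightarrow> finite e \<and> card e = r"
    and "E \<noteq> {}" and "l \<le> r" and "r \<le> l * Suc p" and "p \<ge> 1" and "2 + k * p \<le> s"
  shows "\<exists>F C. F \<subseteq> E \<and> finite F \<and> card F = 2 + k * p \<and> C \<subseteq> F \<and> card C = k \<and>
           (\<forall>e\<in>C. e \<subseteq> \<Union>(F - {e})) \<and> (\<forall>e\<in>F. \<exists>f\<in>F - {e}. l \<le> card (f \<inter> e))"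
  using \<open>2 + k * p \<le> s\<close>
proof (induction k)
  case 0
  obtain e where e: "e \<in> E"
    using \<open>E \<noteq> {}\<close> by blast
  obtain T where T: "T \<subseteq> e" "card T = l"
    using obtain_subset_with_card_n[of l e] E[OF e] \<open>l \<le> r\<close> by auto
  obtain f where f: "f \<in> E" "f \<notin> {e}" "T \<subseteq> f"
    using rich_new_edge[OF rich e T, of "{e}"] 0 by auto
  have "l \<le> card (f \<inter> e)"
    using T f(3) E[OF e] by (metis card_mono finite_Int le_inf_iff)
  then show ?case
    using e f by (intro exI[of _ "{e, f}"] exI[of _ "{}"]) (auto simp: Int_commute)
next
  case (Suc k)
  then obtain F C where FC: "F \<subseteq> E" "finite F" "card F = 2 + k * p" "C \<subseteq> F" "card C = k"
    "\<forall>e\<in>C. e \<subseteq> \<Union>(F - {e})" "\<forall>e\<in>F. \<exists>f\<in>F - {e}. l \<le> card (f \<inter> e)"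
    by auto
  \<comment> \<open>The two starting edges ensure that some edge of \<open>F\<close> lies outside
    \<open>C\<close>.\<close>
  have "k \<le> k * p"
    using \<open>p \<ge> 1\<close> by simp
  then have "card C < card F"
    using FC(3,5) by linarith
  then obtain e where e: "e \<in> F" "e \<notin> C"
    using FC(4) by (metis less_irrefl subsetI subset_antisym)
  then obtain f where f: "f \<in> F - {e}" "l \<le> card (f \<inter> e)"
    using FC(7) by blast
  have eE: "e \<in> E" "finite e" "card e = r"
    using e FC(1) E by auto
  have "card (e - f) = r - card (f \<inter> e)"
    using eE by (simp add: card_Diff_subset_Int Int_commute)
  also have "\<dots> \<le> p * l"
    using f(2) \<open>r \<le> l * Suc p\<close> by (simp add: mult.commute)
  finally have "card (e - f) \<le> p * l" .
  then obtain G where G: "G \<subseteq> E" "G \<inter> F = {}" "finite G" "card G = p"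
    "e - f \<subseteq> \<Union>G" "\<forall>g\<in>G. l \<le> card (g \<inter> e)"
    using rich_cover[OF rich eE(1,2), of "e - f" p F] eE(3) \<open>l \<le> r\<close> FC(2,3) Suc.prems by auto
  have "finite C"
    using FC(2,4) finite_subset by blast
  have 1: "card (F \<union> G) = 2 + Suc k * p"
    using G(2-4) FC(2,3) by (simp add: card_Un_disjoint Int_commute)
  have 2: "card (insert e C) = Suc k"
    using FC(5) e(2) \<open>finite C\<close> by simp
  have "e \<subseteq> \<Union>((F \<union> G) - {e})"
    using G(2,5) f(1) e(1) by blast
  then have 3: "\<forall>x\<in>insert e C. x \<subseteq> \<Union>((F \<union> G) - {x})"
    using FC(6) by blast
  \<comment> \<open>Old edges keep their partners; every new edge has \<open>e\<close> as
    partner.\<close>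
  have 4: "\<exists>y\<in>(F \<union> G) - {x}. l \<le> card (y \<inter> x)" if "x \<in> F \<union> G" for x
  proof (cases "x \<in> F")
    case True
    then show ?thesis
      using FC(7) by blast
  next
    case False
    then have "x \<in> G"
      using that by simp
    then have "e \<in> (F \<union> G) - {x} \<and> l \<le> card (e \<inter> x)"
      using e(1) False G(6) by (auto simp: Int_commute)
    then show ?thesis
      by blast
  qed
  have 5: "F \<union> G \<subseteq> E" "finite (F \<union> G)" "insert e C \<subseteq> F \<union> G"
    using FC(1,2,4) G(1,3) e(1) by auto
  show ?case
    by (intro exI[of _ "F \<union> G"] exI[of _ "insert e C"] conjI 1 2 3 5 ballI 4)
qed

text \<open>Padding \<open>F\<close> to exactly \<open>s\<close> edges only enlarges the unions, so
  edges of \<open>C\<close> still have no private vertex, leaving at most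
  \<open>s - card C < t\<close> candidates.\<close>

lemma not_locally_thinI:
  assumes "F \<subseteq> E" and "finite E" and "card F \<le> s" and "s \<le> card E"
    and "C \<subseteq> F" and "s < card C + t" and "\<And>e. e \<in> C \<Longrightarrow> e \<subseteq> \<Union>(F - {e})"
  shows "\<not> locally_thin s t E"
proof
  assume thin: "locally_thin s t E"
  obtain H where H: "F \<subseteq> H" "H \<subseteq> E" "card H = s"
    using exists_subset_between[of F s E] assms(1-4) by blast
  have "finite H" and "C \<subseteq> H"
    using H assms(2,5) finite_subset by blast+
  have "t \<le> card {e \<in> H. \<exists>v\<in>e. \<forall>f\<in>H - {e}. v \<notin> f}"
    using thin H \<open>finite H\<close> by (auto simp: locally_thin_def)
  also have "\<dots> \<le> card (H - C)"
  proof (rule card_mono)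
    have "\<exists>f\<in>H - {e}. v \<in> f" if "e \<in> C" "v \<in> e" for e v
      using assms(7)[OF that(1)] that(2) H(1) by blast
    then show "{e \<in> H. \<exists>v\<in>e. \<forall>f\<in>H - {e}. v \<notin> f} \<subseteq> H - C"
      by fast
  qed (use \<open>finite H\<close> in simp)
  also have "\<dots> = s - card C"
    using H(3) \<open>finite H\<close> \<open>C \<subseteq> H\<close> by (metis card_Diff_subset finite_subset)
  finally show False
    using assms(6) card_mono[OF \<open>finite H\<close> \<open>C \<subseteq> H\<close>] H(3) by linarith
qed

lemma locally_thin_card_le:
  assumes E: "r_graph_on r V E" and thin: "locally_thin s t E"
    and "t < s" and "l \<le> r" and "r \<le> l * Suc p" and "2 + (s - t + 1) * p \<le> s"
  shows "card E \<le> (s - 1) * (card V choose l) + (s - 1)"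
proof (rule ccontr)
  assume "\<not> ?thesis"
  moreover obtain E' where E': "E' \<subseteq> E" "rich s l E'"
    "card E \<le> card E' + (s - 1) * (card V choose l)"
    using rich_subgraph[OF E] .
  ultimately have big: "s \<le> card E'"
    by linarith
  have E'r: "finite e \<and> card e = r" if "e \<in> E'" for e
    using that E'(1) E by (auto simp: r_graph_on_def intro: finite_subset)
  have "E' \<noteq> {}" and "finite E'"
    using big \<open>t < s\<close> by (auto intro: card_ge_0_finite)
  show False
  \<comment> \<open>\<open>rich_grow\<close> needs \<open>p \<ge> 1\<close>. For
    \<open>p = 0\<close> an edge is its own \<open>l\<close>-subset, and a second edge containing it
    would have to equal it.\<close>
  proof (cases "p = 0")
    case True
    then have "l = r"
      using assms by simp
    obtain e where e: "e \<in> E'"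
      using \<open>E' \<noteq> {}\<close> by blast
    obtain g where "g \<in> E'" "g \<notin> {e}" "e \<subseteq> g"
      using rich_new_edge[OF E'(2) e, of e "{e}"] E'r[OF e] assms(6) \<open>l = r\<close> by auto
    then show False
      using E'r[OF e] E'r[of g] card_subset_eq[of g e] by auto
  next
    case False
    then obtain F C where FC: "F \<subseteq> E'" "finite F" "card F = 2 + (s - t + 1) * p" "C \<subseteq> F"
      "card C = s - t + 1" "\<forall>e\<in>C. e \<subseteq> \<Union>(F - {e})"
      using rich_grow[OF E'(2) E'r \<open>E' \<noteq> {}\<close>, of p "s - t + 1"] assms by fastforce
    have "\<not> locally_thin s t E'"
      using FC \<open>finite E'\<close> big assms(3,6) by (intro not_locally_thinI[of F _ _ C]) auto
    then show False
      using thin E'(1) by (auto simp: locally_thin_def)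
  qed
qed

theorem theorem1p3:
  fixes s t r n :: nat
  assumes "s > t" and "t \<ge> 1" and "r \<ge> 2"
  shows "let l = nat \<lceil>real r / real_of_int \<lfloor>(2 * real s - real t - 1) / (real s - real t + 1)\<rfloor>\<rceil>
         in L_max s t n r \<le> (s - 1) * (n choose l) + (s - 1)"
proof -
  define q where "q = (2 * s - t - 1) div (s - t + 1)"
  define l where "l = nat \<lceil>real r / real q\<rceil>"
  \<comment> \<open>As \<open>s > t \<ge> 1\<close>, the natural subtractions do not
    truncate.\<close>
  have "(2 * real s - real t - 1) / (real s - real t + 1) = real (2 * s - t - 1) / real (s - t + 1)"
    using assms by (simp add: algebra_simps)
  then have q: "\<lfloor>(2 * real s - real t - 1) / (real s - real t + 1)\<rfloor> = int q"
    unfolding q_def by (simp only: floor_divide_of_nat_eq)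
  have "q \<ge> 1"
    using assms unfolding q_def by (simp add: div_greater_zero_iff Suc_le_eq)
  then obtain p where p: "q = Suc p"
    by (cases q) auto
  have "(s - t + 1) * q \<le> 2 * s - t - 1"
    unfolding q_def by (rule times_div_less_eq_dividend)
  \<comment> \<open>Subtract \<open>s - t + 1\<close> from both sides: \<open>2 * s - t - 1\<close>
    is \<open>(s - 2) + (s - t + 1)\<close>.\<close>
  then have bound: "2 + (s - t + 1) * p \<le> s"
    unfolding p mult_Suc_right using assms by linarith
  have "real r / real q \<le> real l"
    unfolding l_def by linarith
  then have "real r \<le> real (l * q)"
    using \<open>q \<ge> 1\<close> by (simp add: divide_le_eq)
  then have "r \<le> l * Suc p"
    unfolding p of_nat_le_iff .
  moreover have "real r / real q \<le> real r"
    using \<open>q \<ge> 1\<close> by (simp add: divide_le_eq mult_le_cancel_left1)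
  then have "l \<le> r"
    unfolding l_def by (simp add: nat_le_iff ceiling_le_iff)
  ultimately have bd: "card E \<le> (s - 1) * (n choose l) + (s - 1)"
    if "card V = n" "r_graph_on r V E" "locally_thin s t E" for V :: "nat set" and E
    using locally_thin_card_le[OF that(2,3) assms(1) _ _ bound, of l] that(1) by blast
  have "L_max s t n r \<le> (s - 1) * (n choose l) + (s - 1)"
    unfolding L_max_def using bd assms L_max_set_finite L_max_set_nonempty
    by (subst Max_le_iff) auto
  then show ?thesis
    by (simp add: q l_def)
qed

end
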